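(* Let $m\ge 1$ be an integer, let $\mathbf{n}=(n_1,\dots,n_m)\in\mathbb{C}^m$ with $\mathrm{Re}(n_i)>-1$ for all $i$, and let $N=\sum_{i=1}^m n_i$. Let $S(\mathbf{p})=-\sum_{i=1}^m p_i\log(p_i)$ be the Shannon entropy. Then the Bayes estimator with uniform prior for $S(\mathbf{p})$, namely $S_1/S_0 := I[S(\mathbf{p}),\mathbf{n}]/I[1,\mathbf{n}]$, is given by $$\frac{S_1}{S_0} = -\sum_{i=1}^m \frac{n_i+1}{N+m}\,\Delta\Phi^{(1)}(n_i+2,\;N+m+1).$$
   Context: For a function $F$ on the simplex $\{\mathbf{p}\in\mathbb{R}^m: p_i\ge 0\ \forall i,\ \sum_i p_i=1\}$ and $\mathbf{n}\in\mathbb{C}^m$, define $I[F(\mathbf{p}),\mathbf{n}] = \int d\mathbf{p}\,F(\mathbf{p})\,\delta\big(\sum_i p_i-1\big)\prod_i\theta(p_i)\prod_{i=1}^m p_i^{n_i}$, where $\theta(x)=1$ for $x\ge0$ and $0$ otherwise. Explicitly, this is the Lebesgue integral of $F(\mathbf{p})\prod_{i=1}^m p_i^{n_i}$ over $\{(p_1,\dots,p_{m-1}): p_i\ge 0,\ \sum_{i=1}^{m-1}p_i\le 1\}$ with respect to $dp_1\cdots dp_{m-1}$, with $p_m=1-\sum_{i=1}^{m-1}p_i$ (for $m=1$ it is the value of the integrand at $p_1=1$). Here $p^{n}=e^{n\log p}$ for $p>0$ and $\log$ is the natural logarithm. For $n\ge1$ and $\mathrm{Re}(z)>0$, $\Phi^{(n)}(z)=\partial_z^{n}\log\Gamma(z)$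 (so $\Phi^{(1)}=\Gamma'/\Gamma$ is the digamma function and $\Phi^{(n)}$ is the $(n-1)$-st derivative of $\Phi^{(1)}$), and $\Delta\Phi^{(n)}(z_1,z_2)=\Phi^{(n)}(z_1)-\Phi^{(n)}(z_2)$. *)

theory Defs
  imports "HOL-Analysis.Analysis"
begin

text \<open>Vectors with \<open>m\<close> components are functions on \<open>nat\<close>, read only at the indices \<open>1, ..., m\<close>.\<close>

definition solid_simplex :: "nat \<Rightarrow> (nat \<Rightarrow> real) set" where
  "solid_simplex m =
     {q \<in> space (Pi\<^sub>M {1..<m} (\<lambda>_. lborel)). (\<forall>i\<in>{1..<m}. 0 \<le> q i) \<and> (\<Sum>i\<in>{1..<m}. q i) \<le> 1}"

definition simplex_point :: "nat \<Rightarrow> (nat \<Rightarrow> real) \<Rightarrow> nat \<Rightarrow> real" where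
  "simplex_point m q = q(m := 1 - (\<Sum>i\<in>{1..<m}. q i))"

definition simplex_integrand ::
    "nat \<Rightarrow> ((nat \<Rightarrow> real) \<Rightarrow> complex) \<Rightarrow> (nat \<Rightarrow> complex) \<Rightarrow> (nat \<Rightarrow> real) \<Rightarrow> complex" where
  "simplex_integrand m F n p = F p * (\<Prod>i\<in>{1..m}. complex_of_real (p i) powr n i)"

text \<open>For \<open>m = 1\<close> the product measure over the empty index set is a point mass of weight one,
  so the integral is the value of the integrand at \<open>p 1 = 1\<close>.\<close>

definition simplex_integrable ::
    "nat \<Rightarrow> ((nat \<Rightarrow> real) \<Rightarrow> complex) \<Rightarrow> (nat \<Rightarrow> complex) \<Rightarrow> bool" where
  "simplex_integrable m F n \<longleftrightarrow>
     set_integrable (Pi\<^sub>M {1..<m} (\<lambda>_. lborel)) (solid_simplex m)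
       (\<lambda>q. simplex_integrand m F n (simplex_point m q))"

definition simplex_integral ::
    "nat \<Rightarrow> ((nat \<Rightarrow> real) \<Rightarrow> complex) \<Rightarrow> (nat \<Rightarrow> complex) \<Rightarrow> complex" where
  "simplex_integral m F n =
     set_lebesgue_integral (Pi\<^sub>M {1..<m} (\<lambda>_. lborel)) (solid_simplex m)
       (\<lambda>q. simplex_integrand m F n (simplex_point m q))"

text \<open>The convention \<open>0 * log 0 = 0\<close> is built in, because \<open>0 * ln 0 = 0\<close> for real \<open>ln\<close>.\<close>

definition shannon_entropy :: "nat \<Rightarrow> (nat \<Rightarrow> real) \<Rightarrow> real" where
  "shannon_entropy m p = - (\<Sum>i\<in>{1..m}. p i * ln (p i))"

text \<open>\<^const>\<open>ln_Gamma\<close> is the branch of the logarithm of \<open>Gamma\<close> that is holomorphic off the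
  nonpositive real axis and real on the positive one; \<open>Ln (Gamma z)\<close> would not be continuous on
  the right half-plane. Meant for \<open>k \<ge> 1\<close> and \<open>Re z > 0\<close>.\<close>

definition Phi :: "nat \<Rightarrow> complex \<Rightarrow> complex" where
  "Phi k z = (deriv ^^ k) ln_Gamma z"

definition Delta_Phi :: "nat \<Rightarrow> complex \<Rightarrow> complex \<Rightarrow> complex" where
  "Delta_Phi k z1 z2 = Phi k z1 - Phi k z2"

lemma Phi_1_eq:
  assumes "Re z > 0"
  shows "Phi 1 z = deriv Gamma z / Gamma z"
proof -
  have z: "z \<notin> \<real>\<^sub>\<le>\<^sub>0" "z \<notin> \<int>\<^sub>\<le>\<^sub>0"
    using assms by (auto simp: complex_nonpos_Reals_iff elim!: nonpos_Ints_cases)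
  have "Phi 1 z = Digamma z"
    using has_field_derivative_ln_Gamma_complex[OF z(1)] by (simp add: Phi_def DERIV_imp_deriv)
  moreover have "deriv Gamma z = Gamma z * Digamma z"
    using has_field_derivative_Gamma[OF z(2)] by (rule DERIV_imp_deriv)
  moreover have "Gamma z \<noteq> 0"
    using z(2) by (simp add: Gamma_eq_zero_iff)
  ultimately show ?thesis by simp
qed

end

theory Submission
  imports Defs
begin

text \<open>With powers cut off at \<open>0\<close>, the integral \<open>I[1, n]\<close> is an iterated convolution, and each
  convolution of two powers is a Beta integral; this gives Dirichlet's formula
  \<open>I[1, n] = (\<Prod>i. Gamma (n i + 1)) / Gamma (N + m)\<close> for complex exponents. Differentiating it in
  \<open>n j\<close> at \<open>n j + 1\<close> brings down \<open>p j * ln (p j)\<close> under the integral and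
  \<open>Digamma (n j + 2) - Digamma (N + m + 1)\<close> outside; summing over \<open>j\<close> yields the entropy.\<close>

section \<open>Gamma on the right half-plane and truncated powers\<close>

lemma not_nonpos_Int_Re_pos: "0 < Re z \<Longrightarrow> z \<notin> \<int>\<^sub>\<le>\<^sub>0"
  by (auto elim!: nonpos_Ints_cases)

lemma Gamma_nonzero_Re_pos: "0 < Re z \<Longrightarrow> Gamma z \<noteq> 0"
  by (simp add: Gamma_eq_zero_iff not_nonpos_Int_Re_pos)

text \<open>Cutting the power off at \<open>0\<close> encodes the simplex constraints in the integrand:
  a product of these factors vanishes as soon as one coordinate is nonpositive.\<close>

definition gpow :: "complex \<Rightarrow> real \<Rightarrow> complex" where
  "gpow a x = (if 0 < x then of_real x powr (a - 1) else 0)"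

lemma gpow_measurable [measurable]: "gpow a \<in> borel_measurable borel"
proof -
  have "gpow a = (\<lambda>x. if 0 < x then exp ((a - 1) * of_real (ln x)) else 0)"
    by (auto simp: gpow_def powr_def Ln_of_real)
  thus ?thesis
    by simp
qed

lemma gpow_nonpos [simp]: "x \<le> 0 \<Longrightarrow> gpow a x = 0"
  by (simp add: gpow_def)

lemma of_real_powr_eq_gpow:
  assumes "0 \<le> x"
  shows "complex_of_real x powr z = gpow (z + 1) x"
  using assms by (auto simp: gpow_def)

lemma gpow_plus1: "gpow (a + 1) x = of_real x * gpow a x"
proof (cases "0 < x")
  case True
  have "complex_of_real x powr a = of_real x powr 1 * of_real x powr (a - 1)"
    by (subst powr_add[symmetric]) simp
  with True show ?thesis by (simp add: gpow_def)
qed (simp add: gpow_def)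

lemma norm_gpow: "norm (gpow a x) = (if 0 < x then x powr (Re a - 1) else 0)"
  by (auto simp: gpow_def norm_powr_real_powr)

lemma gpow_mult:
  assumes "0 < u"
  shows "gpow a (u * x) = of_real u powr (a - 1) * gpow a x"
  using assms by (simp add: gpow_def zero_less_mult_iff powr_times_real)

text \<open>The bare factor \<open>u\<close> is the Jacobian of the substitution
  \<open>y = u * t\<close> in the convolution integral.\<close>

lemma gpow_mult_gpow:
  assumes "0 < u"
  shows "of_real u powr (a - 1) * of_real u powr (c - 1) * of_real u = gpow (a + c) u"
proof -
  have "of_real u powr (a - 1) * of_real u powr (c - 1) * of_real u powr 1 
      = complex_of_real u powr (a + c - 1)"
    by (subst powr_add[symmetric] | simp)+
  with assms show ?thesis
    by (simp add: gpow_def)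
qed

section \<open>Convolution of truncated powers and the Beta integral\<close>

text \<open>Moduli of complex powers depend only on the real parts, so the real Beta integrand
  dominates.\<close>

lemma integrable_gpow_conv_1:
  assumes "0 < Re a" "0 < Re c"
  shows "integrable lborel (\<lambda>t. gpow a t * gpow c (1 - t))"
proof (rule Bochner_Integration.integrable_bound)
  show "integrable lborel
      (\<lambda>t. indicator {0..1} t *\<^sub>R (t powr (Re a - 1) * (1 - t) powr (Re c - 1)))"
    using integrable_Beta[OF assms] by (simp add: set_integrable_def)
qed (auto simp: norm_mult norm_gpow indicator_def intro!: AE_I2)

text \<open>Euler's Beta integral, under a name of its own until \<open>gbeta_eq\<close> evaluates
  it at complex parameters.\<close>

definition gbeta :: "complex \<Rightarrow> complex \<Rightarrow> complex" where
  "gbeta a c = (LBINT t. gpow a t * gpow c (1 - t))"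

text \<open>For \<open>0 < u\<close>, substituting \<open>y = u * t\<close> scales out a power of
  \<open>u\<close> and leaves an integral free of \<open>u\<close>. For \<open>u \<le> 0\<close>,
  \<open>y\<close> and \<open>u - y\<close> are never both positive.\<close>

lemma gpow_conv_aux:
  assumes "0 < Re a" "0 < Re c"
  shows "has_bochner_integral lborel (\<lambda>y. gpow a y * gpow c (u - y)) (gbeta a c * gpow (a + c) u)"
proof (cases "0 < u")
  case True
  let ?f = "\<lambda>y. gpow a y * gpow c (u - y)"
  have *: "?f (0 + u * t) = (of_real u powr (a - 1) * of_real u powr (c - 1)) *
      (gpow a t * gpow c (1 - t))" for t
  proof -
    have "u - u * t = u * (1 - t)"
      by (simp add: algebra_simps)
    thus ?thesis
      by (simp add: gpow_mult[OF True])
  qed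
  have int: "integrable lborel (\<lambda>t. ?f (0 + u * t))"
    unfolding * by (intro integrable_mult_right integrable_gpow_conv_1 assms)
  hence "integrable lborel ?f"
    using lborel_integrable_real_affine_iff[of u ?f 0] True by simp
  moreover have "integral\<^sup>L lborel ?f = u *\<^sub>R (LBINT t. ?f (0 + u * t))"
    using lborel_integral_real_affine[of u ?f 0] True by simp
  hence "integral\<^sup>L lborel ?f
      = of_real u * ((of_real u powr (a - 1) * of_real u powr (c - 1)) * gbeta a c)"
    unfolding * by (simp add: gbeta_def scaleR_conv_of_real)
  hence "integral\<^sup>L lborel ?f = gbeta a c * gpow (a + c) u"
    by (simp add: gpow_mult_gpow[OF True, symmetric] mult_ac)
  ultimately show ?thesis
    by (simp add: has_bochner_integral_iff)
next
  case False
  hence "(\<lambda>y. gpow a y * gpow c (u - y)) = (\<lambda>_. 0)"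
    by (auto simp: fun_eq_iff gpow_def)
  with False show ?thesis by (simp add: has_bochner_integral_zero)
qed

text \<open>Euler's integral enters as a gauge integral. Absolute integrability makes it a Lebesgue
  integral, and Borel measurability carries it from the completed measure to
  \<open>lborel\<close>.\<close>

lemma has_bochner_integral_Gamma:
  assumes "0 < Re a"
  shows "has_bochner_integral lborel (\<lambda>x. gpow a x * of_real (exp (-x))) (Gamma a)"
proof -
  let ?g = "\<lambda>t. complex_of_real t powr (a - 1) / of_real (exp t)"
  have eq: "(\<lambda>x. gpow a x * of_real (exp (-x))) = (\<lambda>x. indicator {0<..} x *\<^sub>R ?g x)"
    by (auto simp: gpow_def fun_eq_iff exp_minus field_simps)
  have abs: "?g absolutely_integrable_on {0<..}"
    by (rule absolutely_integrable_Gamma_integral'[OF assms])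
  have meas: "(\<lambda>x. gpow a x * of_real (exp (-x))) \<in> borel_measurable lborel"
    by measurable
  have "integrable lebesgue (\<lambda>x. gpow a x * of_real (exp (-x)))"
    unfolding eq using abs by (simp add: set_integrable_def)
  hence int: "integrable lborel (\<lambda>x. gpow a x * of_real (exp (-x)))"
    using meas by (simp add: integrable_completion)
  have "integral\<^sup>L lebesgue (\<lambda>x. gpow a x * of_real (exp (-x))) = integral {0<..} ?g"
    unfolding eq using set_lebesgue_integral_eq_integral(2)[OF abs]
    by (simp add: set_lebesgue_integral_def)
  also have "\<dots> = Gamma a"
    using Gamma_integral_complex'[OF assms] by (rule integral_unique)
  finally show ?thesis
    using int meas by (simp add: has_bochner_integral_iff integral_completion)
qed

text \<open>Both sides of \<open>Gamma a * Gamma c = gbeta a c * Gamma (a + c)\<close> are the integral of the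
  convolution of \<open>gpow a x * exp (-x)\<close> and \<open>gpow c x * exp (-x)\<close>.\<close>

lemma gbeta_eq:
  assumes "0 < Re a" "0 < Re c"
  shows "gbeta a c = Gamma a * Gamma c / Gamma (a + c)"
proof -
  define g where "g = (\<lambda>a x. gpow a x * of_real (exp (-x)))"
  have g[measurable]: "g a \<in> borel_measurable borel" for a
    unfolding g_def by measurable
  have g_int: "integrable lborel (g a)" "integral\<^sup>L lborel (g a) = Gamma a" if "0 < Re a" for a
    using has_bochner_integral_Gamma[OF that] by (simp_all add: has_bochner_integral_iff g_def)
  have shift: "integrable lborel (\<lambda>t. g c (t - x))" "(LBINT t. g c (t - x)) = Gamma c" for x
    using lborel_integrable_real_affine[OF g_int(1)[OF assms(2)], of 1 "-x"]
      lborel_integral_real_affine[of 1 "g c" "-x"] g_int(2)[OF assms(2)] by simp_all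
  have nshift: "(LBINT t. norm (g c (t - x))) = (LBINT t. norm (g c t))" for x
    using lborel_integral_real_affine[of 1 "\<lambda>t. norm (g c t)" "-x"] by simp
  have int: "integrable (lborel \<Otimes>\<^sub>M lborel) (\<lambda>(x, t). g a x * g c (t - x))"
  proof (rule lborel_pair.Fubini_integrable)
    \<comment> \<open>By translation invariance the inner integral of the norms depends on
      \<open>x\<close> only through the factor \<open>norm (g a x)\<close>.\<close>
    have "(\<lambda>x. LBINT t. norm (case (x, t) of (x, t) \<Rightarrow> g a x * g c (t - x)))
        = (\<lambda>x. norm (g a x) * (LBINT t. norm (g c t)))"
      by (simp add: norm_mult nshift)
    thus "integrable lborel (\<lambda>x. LBINT t. norm (case (x, t) of (x, t) \<Rightarrow> g a x * g c (t - x)))"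
      using g_int(1)[OF assms(1)] by simp
    show "AE x in lborel. integrable lborel (\<lambda>t. case (x, t) of (x, t) \<Rightarrow> g a x * g c (t - x))"
      using shift by simp
  qed measurable
  have "Gamma a * Gamma c = (LBINT x. LBINT t. g a x * g c (t - x))"
    using g_int(2)[OF assms(1)] by (simp add: shift)
  also have "\<dots> = (LBINT t. LBINT x. g a x * g c (t - x))"
    using lborel_pair.Fubini_integral[OF int] by simp
  also have "(\<lambda>t. LBINT x. g a x * g c (t - x)) = (\<lambda>t. gbeta a c * g (a + c) t)"
  proof
    fix t
    \<comment> \<open>The exponentials combine to \<open>exp (-t)\<close>, which leaves the inner
      integral.\<close>
    have "(\<lambda>x. g a x * g c (t - x)) = (\<lambda>x. of_real (exp (-t)) * (gpow a x * gpow c (t - x)))"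
      by (simp add: g_def fun_eq_iff exp_minus exp_diff field_simps)
    hence "(LBINT x. g a x * g c (t - x)) = of_real (exp (-t)) * (LBINT x. gpow a x * gpow c (t - x))"
      by simp
    thus "(LBINT x. g a x * g c (t - x)) = gbeta a c * g (a + c) t"
      using gpow_conv_aux[OF assms, of t]
      by (simp add: has_bochner_integral_integral_eq) (simp add: g_def)
  qed
  also have "(LBINT t. gbeta a c * g (a + c) t) = gbeta a c * Gamma (a + c)"
    using g_int(2)[of "a + c"] assms by simp
  finally have "Gamma a * Gamma c = gbeta a c * Gamma (a + c)" .
  moreover have "Gamma (a + c) \<noteq> 0"
    using assms by (intro Gamma_nonzero_Re_pos) simp
  ultimately show ?thesis
    by (simp add: field_simps)
qed

lemma has_bochner_integral_gpow_conv:
  assumes "0 < Re a" "0 < Re c"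
  shows "has_bochner_integral lborel (\<lambda>y. gpow a y * gpow c (u - y)) (Beta a c * gpow (a + c) u)"
  using gpow_conv_aux[OF assms] gbeta_eq[OF assms] by (simp add: Beta_def)

text \<open>The modulus of \<open>gpow z\<close> is \<open>gpow\<close> at \<open>Re z\<close>, so
  the convolution formula at real parameters also computes the integral of the modulus. That
  \<open>K\<close> does not depend on \<open>u\<close> is what Tonelli needs in the Dirichlet
  induction.\<close>

lemma nn_integral_norm_gpow_conv:
  assumes "0 < Re a" "0 < Re c"
  obtains K where "0 \<le> K"
    and "\<And>u. (\<integral>\<^sup>+ y. ennreal (norm (gpow a y * gpow c (u - y))) \<partial>lborel)
          = ennreal (K * norm (gpow (a + c) u))"
proof
  let ?K = "norm (Beta (complex_of_real (Re a)) (of_real (Re c)))"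
  show "0 \<le> ?K"
    by simp
  fix u
  let ?f = "\<lambda>y. norm (gpow a y * gpow c (u - y))"
  have eq: "complex_of_real (norm (gpow z x)) = gpow (of_real (Re z)) x" for z x
    by (auto simp: gpow_def norm_powr_real_powr powr_of_real[symmetric])
  have "integrable lborel ?f"
    using has_bochner_integral_gpow_conv[OF assms, of u]
    by (intro integrable_norm) (simp add: has_bochner_integral_iff)
  hence "(\<integral>\<^sup>+ y. ennreal (?f y) \<partial>lborel) = ennreal (integral\<^sup>L lborel ?f)"
    by (intro nn_integral_eq_integral) auto
  also have "integral\<^sup>L lborel ?f = norm (complex_of_real (integral\<^sup>L lborel ?f))"
    by simp
  also have "complex_of_real (integral\<^sup>L lborel ?f) = (LBINT y. complex_of_real (?f y))"
    by simp
  also have "\<dots> = Beta (of_real (Re a)) (of_real (Re c)) * gpow (of_real (Re a) + of_real (Re c)) u"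
    using has_bochner_integral_gpow_conv[of "of_real (Re a)" "of_real (Re c)" u] assms
    by (simp add: has_bochner_integral_iff norm_mult eq)
  also have "norm \<dots> = ?K * norm (gpow (a + c) u)"
    by (simp add: norm_mult norm_gpow)
  finally show "(\<integral>\<^sup>+ y. ennreal (?f y) \<partial>lborel) = ennreal (?K * norm (gpow (a + c) u))" .
qed

section \<open>Dirichlet's integral for complex exponents\<close>

text \<open>Induction with \<open>c\<close> arbitrary: integrating out one coordinate convolves its
  power with the last one, and reproduces the integrand with \<open>c\<close> replaced by
  \<open>a i + c\<close>, times \<open>Beta (a i) c\<close>.\<close>

lemma has_bochner_integral_dirichlet:
  fixes a :: "'i \<Rightarrow> complex"
  assumes "finite I" "\<And>i. i \<in> I \<Longrightarrow> 0 < Re (a i)" "0 < Re c"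
  shows "has_bochner_integral (Pi\<^sub>M I (\<lambda>_. lborel))
           (\<lambda>q. (\<Prod>i\<in>I. gpow (a i) (q i)) * gpow c (1 - (\<Sum>i\<in>I. q i)))
           ((\<Prod>i\<in>I. Gamma (a i)) * Gamma c / Gamma ((\<Sum>i\<in>I. a i) + c))"
  using assms
proof (induction I arbitrary: c rule: finite_induct)
  case empty
  \<comment> \<open>The product measure over the empty index set is a unit point mass, so only this
    value remains.\<close>
  have "gpow c 1 = 1"
    by (simp add: gpow_def)
  moreover have "Gamma c \<noteq> 0"
    using empty by (intro Gamma_nonzero_Re_pos)
  ultimately show ?case
    by (simp add: PiM_empty has_bochner_integral_iff lebesgue_integral_count_space_finite
        integrable_count_space)
next
  case (insert i I)
  interpret product_sigma_finite "\<lambda>_ :: 'i. lborel :: real measure" ..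
  let ?P = "\<lambda>I. Pi\<^sub>M I (\<lambda>_ :: 'i. lborel :: real measure)"
  let ?F = "\<lambda>I c q. (\<Prod>i\<in>I. gpow (a i) (q i)) * gpow c (1 - (\<Sum>i\<in>I. q i))"
  have pos: "0 < Re (a i)" "0 < Re (a i + c)"
    using insert.prems by (auto intro!: add_pos_pos)
  have IH: "has_bochner_integral (?P I) (?F I (a i + c))
      ((\<Prod>i\<in>I. Gamma (a i)) * Gamma (a i + c) / Gamma ((\<Sum>i\<in>I. a i) + (a i + c)))"
    using pos insert.prems by (intro insert.IH) auto
  have upd: "?F (insert i I) c (q(i := y)) =
      (\<Prod>i\<in>I. gpow (a i) (q i)) * (gpow (a i) y * gpow c ((1 - (\<Sum>i\<in>I. q i)) - y))" for q y
  proof -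
    have "(\<Prod>j\<in>I. gpow (a j) ((q(i := y)) j)) = (\<Prod>j\<in>I. gpow (a j) (q j))"
      "(\<Sum>j\<in>I. (q(i := y)) j) = (\<Sum>j\<in>I. q j)"
      using insert.hyps by (auto intro!: prod.cong sum.cong)
    thus ?thesis
      using insert.hyps by (simp add: algebra_simps)
  qed
  have meas: "?F (insert i I) c \<in> borel_measurable (?P (insert i I))"
    by measurable
  obtain K where K: "0 \<le> K"
      "\<And>u. (\<integral>\<^sup>+ y. ennreal (norm (gpow (a i) y * gpow c (u - y))) \<partial>lborel)
          = ennreal (K * norm (gpow (a i + c) u))"
    using nn_integral_norm_gpow_conv[OF pos(1) insert.prems(2)] by blast
  \<comment> \<open>Fubini needs integrability first: Tonelli for the norms reduces it to the
    integrability in the induction hypothesis.\<close>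
  have "(\<integral>\<^sup>+ q. ennreal (norm (?F (insert i I) c q)) \<partial>?P (insert i I))
      = (\<integral>\<^sup>+ q. \<integral>\<^sup>+ y. ennreal (norm (?F (insert i I) c (q(i := y)))) \<partial>lborel \<partial>?P I)"
    using insert.hyps by (intro product_nn_integral_insert) auto
  also have "\<dots> = (\<integral>\<^sup>+ q. ennreal K * ennreal (norm (?F I (a i + c) q)) \<partial>?P I)"
  proof (rule nn_integral_cong)
    fix q
    have "(\<integral>\<^sup>+ y. ennreal (norm (?F (insert i I) c (q(i := y)))) \<partial>lborel)
        = (\<integral>\<^sup>+ y. ennreal (norm (\<Prod>i\<in>I. gpow (a i) (q i))) *
            ennreal (norm (gpow (a i) y * gpow c ((1 - (\<Sum>i\<in>I. q i)) - y))) \<partial>lborel)"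
      unfolding upd by (simp add: norm_mult ennreal_mult)
    also have "\<dots> = ennreal (norm (\<Prod>i\<in>I. gpow (a i) (q i))) *
        ennreal (K * norm (gpow (a i + c) (1 - (\<Sum>i\<in>I. q i))))"
      by (subst nn_integral_cmult) (auto simp: K(2))
    also have "\<dots> = ennreal K * ennreal (norm (?F I (a i + c) q))"
      using K(1) by (simp add: norm_mult mult_ac flip: ennreal_mult)
    finally show "(\<integral>\<^sup>+ y. ennreal (norm (?F (insert i I) c (q(i := y)))) \<partial>lborel)
        = ennreal K * ennreal (norm (?F I (a i + c) q))" .
  qed
  also have "\<dots> = ennreal K * (\<integral>\<^sup>+ q. ennreal (norm (?F I (a i + c) q)) \<partial>?P I)"
    by (intro nn_integral_cmult) measurable
  also have "\<dots> < \<infinity>"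
    using IH by (auto simp: has_bochner_integral_iff integrable_iff_bounded ennreal_mult_less_top)
  finally have int: "integrable (?P (insert i I)) (?F (insert i I) c)"
    using meas by (simp add: integrable_iff_bounded)
  have "integral\<^sup>L (?P (insert i I)) (?F (insert i I) c)
      = (\<integral>q. (\<integral>y. ?F (insert i I) c (q(i := y)) \<partial>lborel) \<partial>?P I)"
    using insert.hyps int by (intro product_integral_insert) auto
  also have "\<dots> = (\<integral>q. Beta (a i) c * ?F I (a i + c) q \<partial>?P I)"
  proof (rule Bochner_Integration.integral_cong[OF refl])
    fix q
    have "(\<integral>y. ?F (insert i I) c (q(i := y)) \<partial>lborel)
        = (\<Prod>i\<in>I. gpow (a i) (q i)) * (Beta (a i) c * gpow (a i + c) (1 - (\<Sum>i\<in>I. q i)))"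
      unfolding upd using has_bochner_integral_gpow_conv[OF pos(1) insert.prems(2)]
      by (simp add: has_bochner_integral_integral_eq)
    thus "(\<integral>y. ?F (insert i I) c (q(i := y)) \<partial>lborel) = Beta (a i) c * ?F I (a i + c) q"
      by (simp add: mult_ac)
  qed
  also have "\<dots> = Beta (a i) c *
      ((\<Prod>i\<in>I. Gamma (a i)) * Gamma (a i + c) / Gamma ((\<Sum>i\<in>I. a i) + (a i + c)))"
    using IH by (simp add: has_bochner_integral_iff)
  \<comment> \<open>The denominator \<open>Gamma (a i + c)\<close> of the Beta value cancels against
    the same factor from the induction hypothesis.\<close>
  also have "\<dots> = (\<Prod>i\<in>insert i I. Gamma (a i)) * Gamma c / Gamma ((\<Sum>i\<in>insert i I. a i) + c)"
    using insert.hyps Gamma_nonzero_Re_pos[OF pos(2)] by (simp add: Beta_def add_ac)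
  finally show ?case
    using int by (simp add: has_bochner_integral_iff)
qed

section \<open>From the product space to the simplex\<close>

text \<open>With \<open>a i = n i + 1\<close> this is the integrand of \<open>I[1, n]\<close>,
  extended by zero off the simplex and hence integrable over the whole product space.\<close>

definition simplex_kernel :: "nat \<Rightarrow> (nat \<Rightarrow> complex) \<Rightarrow> (nat \<Rightarrow> real) \<Rightarrow> complex" where
  "simplex_kernel m a q = (\<Prod>i\<in>{1..m}. gpow (a i) (simplex_point m q i))"

lemma simplex_point_less [simp]: "i < m \<Longrightarrow> simplex_point m q i = q i"
  by (simp add: simplex_point_def)

lemma simplex_point_last: "simplex_point m q m = 1 - (\<Sum>i\<in>{1..<m}. q i)"
  by (simp add: simplex_point_def)

lemma sum_simplex_point:
  assumes "1 \<le> m"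
  shows "(\<Sum>i\<in>{1..m}. simplex_point m q i) = 1"
  unfolding sum.last_plus[OF assms] simplex_point_last by simp

lemma simplex_kernel_alt:
  assumes "1 \<le> m"
  shows "simplex_kernel m a
    = (\<lambda>q. (\<Prod>i\<in>{1..<m}. gpow (a i) (q i)) * gpow (a m) (1 - (\<Sum>i\<in>{1..<m}. q i)))"
  unfolding simplex_kernel_def prod.last_plus[OF assms]
  by (simp add: simplex_point_last mult.commute)

lemma has_bochner_integral_simplex_kernel:
  assumes "1 \<le> m" "\<And>i. i \<in> {1..m} \<Longrightarrow> 0 < Re (a i)"
  shows "has_bochner_integral (Pi\<^sub>M {1..<m} (\<lambda>_. lborel)) (simplex_kernel m a)
           ((\<Prod>i\<in>{1..m}. Gamma (a i)) / Gamma (\<Sum>i\<in>{1..m}. a i))"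
  using has_bochner_integral_dirichlet[of "{1..<m}" a "a m"] assms
  unfolding simplex_kernel_alt[OF assms(1)] prod.last_plus[OF assms(1)] sum.last_plus[OF assms(1)]
  by (simp add: mult_ac add_ac)

lemma simplex_kernel_eq_0:
  assumes "i \<in> {1..m}" "simplex_point m q i \<le> 0"
  shows "simplex_kernel m a q = 0"
  using assms by (auto simp: simplex_kernel_def intro!: prod_zero bexI[of _ i])

lemma solid_simplex_iff:
  assumes "1 \<le> m"
  shows "q \<in> solid_simplex m \<longleftrightarrow>
    q \<in> space (Pi\<^sub>M {1..<m} (\<lambda>_. lborel)) \<and> (\<forall>i\<in>{1..m}. 0 \<le> simplex_point m q i)"
proof -
  have "{1..m} = insert m {1..<m}"
    using assms by auto
  hence "(\<forall>i\<in>{1..m}. 0 \<le> simplex_point m q i) \<longleftrightarrow>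
      0 \<le> simplex_point m q m \<and> (\<forall>i\<in>{1..<m}. 0 \<le> simplex_point m q i)"
    by simp
  also have "\<dots> \<longleftrightarrow> (\<Sum>i\<in>{1..<m}. q i) \<le> 1 \<and> (\<forall>i\<in>{1..<m}. 0 \<le> q i)"
    unfolding simplex_point_last by simp
  finally show ?thesis
    by (auto simp: solid_simplex_def)
qed

text \<open>Off the simplex some coordinate is negative and its factor annihilates the kernel, so
  the kernel absorbs the indicator.\<close>

lemma simplex_integrand_eq_kernel:
  assumes m: "1 \<le> m" and q: "q \<in> space (Pi\<^sub>M {1..<m} (\<lambda>_. lborel))"
  shows "indicator (solid_simplex m) q *\<^sub>R simplex_integrand m F n (simplex_point m q)
       = F (simplex_point m q) * simplex_kernel m (\<lambda>i. n i + 1) q"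
proof (cases "\<forall>i\<in>{1..m}. 0 \<le> simplex_point m q i")
  case True
  hence "q \<in> solid_simplex m"
    using q solid_simplex_iff[OF m] by blast
  moreover have "(\<Prod>i\<in>{1..m}. complex_of_real (simplex_point m q i) powr n i)
      = simplex_kernel m (\<lambda>i. n i + 1) q"
    unfolding simplex_kernel_def using True by (intro prod.cong) (auto simp: of_real_powr_eq_gpow)
  ultimately show ?thesis
    by (simp add: simplex_integrand_def)
next
  case False
  hence "q \<notin> solid_simplex m"
    using solid_simplex_iff[OF m] by blast
  moreover have "simplex_kernel m (\<lambda>i. n i + 1) q = 0"
    using False simplex_kernel_eq_0[of _ m q] by force
  ultimately show ?thesis by simp
qed

text \<open>Isolates the one factor that varies with the \<open>j\<close>-th exponent, the variable
  of the later differentiation.\<close>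

lemma simplex_kernel_shift:
  assumes "j \<in> {1..m}"
  shows "simplex_kernel m (a(j := z)) q
    = gpow z (simplex_point m q j) * (\<Prod>i\<in>{1..m} - {j}. gpow (a i) (simplex_point m q i))"
proof -
  have "(\<Prod>i\<in>{1..m} - {j}. gpow ((a(j := z)) i) (simplex_point m q i))
      = (\<Prod>i\<in>{1..m} - {j}. gpow (a i) (simplex_point m q i))"
    by (intro prod.cong) auto
  thus ?thesis
    unfolding simplex_kernel_def using assms by (subst prod.remove[of _ j]) auto
qed

section \<open>Differentiation in one exponent under the integral\<close>

lemma gpow_add_of_real:
  assumes "0 < x"
  shows "gpow (a + of_real h) x = of_real (x powr h) * gpow a x"
proof -
  have "complex_of_real x powr (a + of_real h - 1) = of_real x powr of_real h * of_real x powr (a - 1)"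
    by (subst powr_add[symmetric]) (simp add: algebra_simps)
  thus ?thesis
    using assms by (simp add: gpow_def powr_of_real)
qed

text \<open>The tangent inequality for \<open>exp\<close> puts the quotient between
  \<open>ln x\<close> and \<open>0\<close>, and \<open>- ln x = ln (1 / x)\<close> is at most
  \<open>1 / x\<close>. The bound is uniform in \<open>h\<close>, as dominated convergence
  requires.\<close>

lemma powr_diff_quotient_bound:
  fixes x h :: real
  assumes "0 < x" "x \<le> 1" "0 < h"
  shows "\<bar>(x powr h - 1) / h\<bar> * x \<le> 1"
proof -
  have "1 + h * ln x \<le> x powr h"
    using assms exp_ge_add_one_self[of "h * ln x"] by (simp add: powr_def)
  moreover have "x powr h \<le> 1"
    using assms by (simp add: powr_le1)
  ultimately have "\<bar>(x powr h - 1) / h\<bar> \<le> - ln x"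
    using assms by (simp add: field_simps abs_if)
  also have "- ln x \<le> 1 / x"
    using assms ln_le_minus_one[of "1 / x"] by (simp add: ln_div)
  finally show ?thesis
    using assms by (simp add: field_simps)
qed

text \<open>Difference quotients of Dirichlet's formula have their limit computed twice: dominated
  convergence gives the integral with the logarithm, the derivative of the Gamma quotient gives the
  Digamma terms.\<close>

lemma has_bochner_integral_ln_simplex_kernel:
  assumes m: "1 \<le> m" and a: "\<And>i. i \<in> {1..m} \<Longrightarrow> 0 < Re (a i)" and j: "j \<in> {1..m}"
  defines "A \<equiv> \<Sum>i\<in>{1..m}. a i"
  shows "has_bochner_integral (Pi\<^sub>M {1..<m} (\<lambda>_. lborel))
           (\<lambda>q. of_real (simplex_point m q j * ln (simplex_point m q j)) * simplex_kernel m a q)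
           ((\<Prod>i\<in>{1..m}. Gamma (a i)) / Gamma A * (a j / A * (Digamma (a j + 1) - Digamma (A + 1))))"
proof -
  let ?M = "Pi\<^sub>M {1..<m} (\<lambda>_. lborel)"
  define R where "R = (\<Sum>i\<in>{1..m} - {j}. a i)"
  define C where "C = (\<Prod>i\<in>{1..m} - {j}. Gamma (a i))"
  \<comment> \<open>The Dirichlet value as a function of the \<open>j\<close>-th exponent alone; the
    other exponents are frozen in \<open>R\<close> and \<open>C\<close>.\<close>
  define D where "D z = Gamma z * C / Gamma (z + R)" for z
  define h where "h k = inverse (real (Suc k))" for k
  have h: "0 < h k" and h_nz: "h k \<noteq> 0" for k
    by (simp_all add: h_def)
  have A: "A = a j + R"
    unfolding A_def R_def using j by (subst sum.remove[of _ j]) auto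
  have C: "(\<Prod>i\<in>{1..m}. Gamma (a i)) = Gamma (a j) * C"
    unfolding C_def using j by (subst prod.remove[of _ j]) auto
  \<comment> \<open>Only the weak inequality is available: for \<open>m = 1\<close> the sum is
    empty.\<close>
  have R: "0 \<le> Re R"
    unfolding R_def Re_sum using a by (intro sum_nonneg) (auto intro: less_imp_le)
  have aj: "0 < Re (a j)"
    using a j by auto
  have D: "has_bochner_integral ?M (simplex_kernel m (a(j := z))) (D z)" if "0 < Re z" for z
  proof -
    have "has_bochner_integral ?M (simplex_kernel m (a(j := z)))
        ((\<Prod>i\<in>{1..m}. Gamma ((a(j := z)) i)) / Gamma (\<Sum>i\<in>{1..m}. (a(j := z)) i))"
      using that a by (intro has_bochner_integral_simplex_kernel m) auto
    moreover have "(\<Prod>i\<in>{1..m}. Gamma ((a(j := z)) i)) = Gamma z * C"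
      unfolding C_def using j by (subst prod.remove[of _ j]) (auto intro!: prod.cong)
    moreover have "(\<Sum>i\<in>{1..m}. (a(j := z)) i) = z + R"
      unfolding R_def using j by (subst sum.remove[of _ j]) (auto intro!: sum.cong)
    ultimately show ?thesis
      unfolding D_def by metis
  qed
  define z where "z = a j + 1"
  have z: "0 < Re z" "0 < Re (z + R)"
    using aj R by (auto simp: z_def)
  have D_deriv: "(D has_field_derivative D z * (Digamma z - Digamma (z + R))) (at z)"
    unfolding D_def using not_nonpos_Int_Re_pos[OF z(1)] not_nonpos_Int_Re_pos[OF z(2)] Gamma_nonzero_Re_pos[OF z(2)]
    by (auto intro!: derivative_eq_intros simp: field_simps)
  \<comment> \<open>Raising the exponent \<open>a j\<close> by one supplies the factor \<open>x\<close> that keeps the difference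
    quotients \<open>x * (x powr h - 1) / h\<close> bounded by \<open>1\<close> as \<open>h\<close> decreases to \<open>0\<close>, so that
    \<open>simplex_kernel m a\<close> dominates.\<close>
  define s where "s k q =
      (simplex_kernel m (a(j := z + of_real (h k))) q - simplex_kernel m (a(j := z)) q) / of_real (h k)"
    for k q
  define f where "f q = of_real (simplex_point m q j * ln (simplex_point m q j)) * simplex_kernel m a q" for q
  have s_int: "has_bochner_integral ?M (s k) ((D (z + of_real (h k)) - D z) / of_real (h k))" for k
    unfolding s_def using z h[of k]
    by (intro has_bochner_integral_divide has_bochner_integral_diff D) (auto intro: add_pos_pos)
  \<comment> \<open>Where the kernel is nonzero, all coordinates are positive and sum to
    \<open>1\<close>, so each is at most \<open>1\<close>.\<close>
  have zero_or: "simplex_kernel m b q = 0 \<or> 0 < simplex_point m q j \<and> simplex_point m q j \<le> 1" for b q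
  proof (cases "\<forall>i\<in>{1..m}. 0 < simplex_point m q i")
    case True
    hence "simplex_point m q j \<le> (\<Sum>i\<in>{1..m}. simplex_point m q i)"
      using j by (intro member_le_sum) (auto intro: less_imp_le)
    hence "simplex_point m q j \<le> 1"
      unfolding sum_simplex_point[OF m] .
    with True j show ?thesis
      by blast
  next
    case False
    thus ?thesis
      using simplex_kernel_eq_0[of _ m q b] by force
  qed
  have kernel_a: "simplex_kernel m a q = simplex_kernel m (a(j := a j)) q" for q
    by simp
  \<comment> \<open>The factor \<open>x\<close> comes from the unit shift in
    \<open>z = a j + 1\<close>, the quotient from the further shift by \<open>h k\<close>.\<close>
  have s_eq: "s k q = of_real ((x powr h k - 1) / h k * x) * simplex_kernel m a q"
    if "x = simplex_point m q j" "0 < x" for k q x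
    unfolding s_def z_def kernel_a[of q] simplex_kernel_shift[OF j] that(1)[symmetric]
      gpow_add_of_real[OF that(2)] gpow_plus1
    using h[of k] by (simp add: field_simps)
  have s_0: "s k q = 0" "f q = 0" if "\<not> (0 < simplex_point m q j \<and> simplex_point m q j \<le> 1)" for k q
    using zero_or[of _ q] that by (auto simp: s_def f_def)
  have h_lim: "h \<longlonglongrightarrow> 0"
    unfolding h_def using LIMSEQ_inverse_real_of_nat .
  have h_lim0: "filterlim h (at 0) sequentially"
    using h_lim by (simp add: filterlim_at h_nz)
  have lim: "(\<lambda>k. s k q) \<longlonglongrightarrow> f q" for q
  proof (cases "0 < simplex_point m q j \<and> simplex_point m q j \<le> 1")
    case True
    define x where "x = simplex_point m q j"
    have "((\<lambda>t. x powr t) has_real_derivative ln x) (at 0)"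
      using True by (auto intro!: derivative_eq_intros simp: x_def)
    hence "(\<lambda>t. (x powr t - 1) / t) \<midarrow>0\<rightarrow> ln x"
      using True by (simp add: DERIV_def x_def)
    hence "(\<lambda>k. (x powr h k - 1) / h k) \<longlonglongrightarrow> ln x"
      using h_lim0 by (rule filterlim_compose)
    hence "(\<lambda>k. of_real ((x powr h k - 1) / h k * x) * simplex_kernel m a q)
        \<longlonglongrightarrow> of_real (ln x * x) * simplex_kernel m a q"
      by (intro tendsto_intros)
    thus ?thesis
      using s_eq[OF x_def] True by (simp add: f_def x_def mult_ac)
  qed (simp add: s_0)
  have bound: "norm (s k q) \<le> norm (simplex_kernel m a q)" for k q
  proof (cases "0 < simplex_point m q j \<and> simplex_point m q j \<le> 1")
    case True
    define x where "x = simplex_point m q j"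
    have "\<bar>(x powr h k - 1) / h k\<bar> * x \<le> 1"
      using True h by (intro powr_diff_quotient_bound) (auto simp: x_def)
    moreover have x: "0 < x"
      using True by (simp add: x_def)
    ultimately have "\<bar>(x powr h k - 1) / h k * x\<bar> * norm (simplex_kernel m a q)
        \<le> norm (simplex_kernel m a q)"
      by (intro mult_left_le_one_le) (auto simp: abs_mult)
    thus ?thesis
      unfolding s_eq[OF x_def x] norm_mult norm_of_real .
  qed (simp add: s_0)
  have w: "integrable ?M (\<lambda>q. norm (simplex_kernel m a q))"
    using has_bochner_integral_simplex_kernel[OF m a]
    by (intro integrable_norm) (simp add: has_bochner_integral_iff)
  have s_meas: "s k \<in> borel_measurable ?M" for k
    using s_int[of k] by (simp add: has_bochner_integral_iff borel_measurable_integrable)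
  have f_meas: "f \<in> borel_measurable ?M"
    by (rule borel_measurable_LIMSEQ_metric[OF s_meas lim])
  note dom = f_meas s_meas w AE_I2[OF lim] AE_I2[OF bound]
  have "(\<lambda>k. integral\<^sup>L ?M (s k)) \<longlonglongrightarrow> integral\<^sup>L ?M f"
    by (rule integral_dominated_convergence[OF dom])
  hence "(\<lambda>k. (D (z + of_real (h k)) - D z) / of_real (h k)) \<longlonglongrightarrow> integral\<^sup>L ?M f"
    using s_int by (simp add: has_bochner_integral_iff)
  moreover have "(\<lambda>k. (D (z + of_real (h k)) - D z) / of_real (h k))
      \<longlonglongrightarrow> D z * (Digamma z - Digamma (z + R))"
  proof -
    have "filterlim (\<lambda>k. complex_of_real (h k)) (at 0) sequentially"
      using tendsto_of_real[OF h_lim] by (simp add: filterlim_at h_nz)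
    from filterlim_compose[OF D_deriv[unfolded DERIV_def] this] show ?thesis .
  qed
  ultimately have "integral\<^sup>L ?M f = D z * (Digamma z - Digamma (z + R))"
    by (rule LIMSEQ_unique)
  moreover have "integrable ?M f"
    by (rule integrable_dominated_convergence[OF dom])
  moreover have "D z * (Digamma z - Digamma (z + R))
      = (\<Prod>i\<in>{1..m}. Gamma (a i)) / Gamma A * (a j / A * (Digamma (a j + 1) - Digamma (A + 1)))"
  proof -
    have zR: "z + R = A + 1"
      by (simp add: z_def A)
    have "0 < Re A"
      using aj R by (simp add: A)
    \<comment> \<open>The functional equation at \<open>A\<close> and at \<open>a j\<close> turns
      \<open>D z\<close> into \<open>a j / A\<close> times the Dirichlet value for
      \<open>a\<close>.\<close>
    hence "Gamma (A + 1) = A * Gamma A" "Gamma z = a j * Gamma (a j)"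
      unfolding z_def using not_nonpos_Int_Re_pos aj by (auto intro!: Gamma_plus1)
    thus ?thesis
      unfolding D_def zR C by (simp add: z_def mult_ac)
  qed
  ultimately show ?thesis
    by (simp add: has_bochner_integral_iff f_def[abs_def])
qed

section \<open>The Bayes estimator of the entropy\<close>

lemma Phi_1_eq_Digamma:
  assumes "0 < Re z"
  shows "Phi 1 z = Digamma z"
proof -
  have "z \<notin> \<real>\<^sub>\<le>\<^sub>0"
    using assms by (auto simp: complex_nonpos_Reals_iff)
  from has_field_derivative_ln_Gamma_complex[OF this] show ?thesis
    by (simp add: Phi_def DERIV_imp_deriv)
qed

theorem theorem7:
  fixes m :: nat and n :: "nat \<Rightarrow> complex" and N :: complex
  assumes "m \<ge> 1"
    and "\<And>i. i \<in> {1..m} \<Longrightarrow> Re (n i) > -1"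
    and "N = (\<Sum>i\<in>{1..m}. n i)"
  shows "simplex_integrable m (\<lambda>p. complex_of_real (shannon_entropy m p)) n
    \<and> simplex_integrable m (\<lambda>_. 1) n
    \<and> simplex_integral m (\<lambda>_. 1) n \<noteq> 0
    \<and> simplex_integral m (\<lambda>p. complex_of_real (shannon_entropy m p)) n
        / simplex_integral m (\<lambda>_. 1) n
      = - (\<Sum>i\<in>{1..m}. (n i + 1) / (N + of_nat m)
             * Delta_Phi 1 (n i + 2) (N + of_nat m + 1))"
proof -
  let ?M = "Pi\<^sub>M {1..<m} (\<lambda>_. lborel)"
  let ?a = "\<lambda>i. n i + 1"
  define A where "A = N + of_nat m"
  define S0 where "S0 = (\<Prod>i\<in>{1..m}. Gamma (?a i)) / Gamma A"
  define T where "T j = ?a j / A * (Digamma (n j + 2) - Digamma (A + 1))" for j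
  have A: "A = (\<Sum>i\<in>{1..m}. ?a i)"
    by (simp add: A_def assms(3) sum.distrib)
  have a: "0 < Re (?a i)" if "i \<in> {1..m}" for i
    using assms(2)[OF that] by simp
  have A_pos: "0 < Re A"
    unfolding A Re_sum using a assms(1) by (intro sum_pos) auto
  \<comment> \<open>Carries both integrability and value from the kernel form to the set integrals
    over the simplex.\<close>
  have int_iff: "simplex_integrable m F n \<and> simplex_integral m F n = I"
    if "has_bochner_integral ?M (\<lambda>q. F (simplex_point m q) * simplex_kernel m ?a q) I" for F I
    using that simplex_integrand_eq_kernel[OF assms(1), of _ F n]
    unfolding simplex_integrable_def simplex_integral_def set_integrable_def
      set_lebesgue_integral_def has_bochner_integral_iff
    by (simp cong: Bochner_Integration.integrable_cong Bochner_Integration.integral_cong)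
  have 0: "simplex_integrable m (\<lambda>_. 1) n \<and> simplex_integral m (\<lambda>_. 1) n = S0"
    using has_bochner_integral_simplex_kernel[of m ?a, OF assms(1) a]
    by (intro int_iff) (simp add: S0_def A)
  \<comment> \<open>Linearity: the entropy is minus the sum of the terms just integrated. The common
    factor \<open>S0\<close> cancels in the final quotient.\<close>
  have "has_bochner_integral ?M (\<lambda>q. - (\<Sum>j\<in>{1..m}.
      of_real (simplex_point m q j * ln (simplex_point m q j)) * simplex_kernel m ?a q))
      (- (\<Sum>j\<in>{1..m}. S0 * T j))"
    using has_bochner_integral_ln_simplex_kernel[of m ?a, OF assms(1) a]
    by (intro has_bochner_integral_minus has_bochner_integral_sum)
      (simp add: S0_def T_def A add_ac)
  hence 1: "simplex_integrable m (\<lambda>p. complex_of_real (shannon_entropy m p)) n \<and>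
      simplex_integral m (\<lambda>p. complex_of_real (shannon_entropy m p)) n = - (\<Sum>j\<in>{1..m}. S0 * T j)"
    by (intro int_iff) (simp add: shannon_entropy_def sum_distrib_right)
  \<comment> \<open>\<open>Gamma A\<close> has to be nonzero as well, because division by zero
    yields \<open>0\<close>.\<close>
  have "S0 \<noteq> 0"
    unfolding S0_def using a A_pos by (auto simp: Gamma_nonzero_Re_pos)
  moreover have "T i = (n i + 1) / (N + of_nat m) * Delta_Phi 1 (n i + 2) (N + of_nat m + 1)"
    if "i \<in> {1..m}" for i
    using a[OF that] A_pos by (simp add: T_def A_def Delta_Phi_def Phi_1_eq_Digamma del: One_nat_def)
  hence "(\<Sum>i\<in>{1..m}. T i)
      = (\<Sum>i\<in>{1..m}. (n i + 1) / (N + of_nat m) * Delta_Phi 1 (n i + 2) (N + of_nat m + 1))"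
    by (intro sum.cong refl)
  ultimately show ?thesis
    using 0 1 by (simp add: sum_distrib_left[symmetric])
qed

end
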